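(* Let $A$ and $B$ be Banach algebras and let $T : B \to A$ be a continuous algebra homomorphism. Let $A\times_T B$ denote the Banach space $A\oplus B$ equipped with the multiplication $$(a_1,b_1)\bullet_T(a_2,b_2) = (a_1a_2 + T(b_1)a_2 + a_1T(b_2),\; b_1b_2),$$ and let $A\oplus_{\rm alg} B$ denote the Banach space $A\oplus B$ equipped with the coordinatewise product $$(a_1,b_1)\cdot(a_2,b_2) = (a_1a_2,\, b_1b_2).$$ Define $\phi : A\times_T B \to A\oplus_{\rm alg} B$ by $\phi(a,b) = (a+T(b),\, b)$. Then $\phi$ is continuous, linear and bijective, and $$\phi\big((a,b)\bullet_T(c,d)\big) = \phi(a,b)\cdot\phi(c,d)$$ for all $a,c\in A$ and $b,d\in B$. In particular, $A\times_T B$ is isomorphic as a Banach algebra to $A\oplus_{\rm alg} B$.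
   Context: Banach algebras are over $\mathbb{C}$, and are not assumed to be unital or commutative. The Banach space $A\oplus B$ is the usual direct sum of Banach spaces, with any of the usual equivalent norms, e.g. $\|(a,b)\|=\|a\|+\|b\|$. The multiplication $\bullet_T$ is continuous and associative; by passing to an equivalent norm if necessary to obtain a submultiplicative norm, $A\times_T B$ is regarded as a Banach algebra. An isomorphism of Banach algebras means a bijective algebra homomorphism that is continuous with continuous inverse (not necessarily isometric). *)

theory Defs
  imports "HOL-Analysis.Analysis"
begin

section \<open>Complex Banach spaces and Banach algebras\<close>

class complex_vector = real_vector +
  fixes scaleC :: "complex \<Rightarrow> 'a \<Rightarrow> 'a" (infixr "*\<^sub>C" 75)
  assumes scaleC_add_right: "z *\<^sub>C (x + y) = z *\<^sub>C x + z *\<^sub>C y"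
    and scaleC_add_left: "(z + w) *\<^sub>C x = z *\<^sub>C x + w *\<^sub>C x"
    and scaleC_scaleC: "z *\<^sub>C w *\<^sub>C x = (z * w) *\<^sub>C x"
    and scaleC_one: "1 *\<^sub>C x = x"
    and scaleC_of_real: "complex_of_real r *\<^sub>C x = r *\<^sub>R x"

class complex_normed_vector = complex_vector + real_normed_vector +
  assumes norm_scaleC: "norm (z *\<^sub>C x) = cmod z * norm x"

class complex_banach = complex_normed_vector + banach

text \<open>The library class \<open>real_normed_algebra\<close> requires neither a unit nor commutativity,
  and its norm is submultiplicative.\<close>

class complex_banach_algebra = complex_banach + real_normed_algebra +
  assumes mult_scaleC_left: "(z *\<^sub>C x) * y = z *\<^sub>C (x * y)"
    and mult_scaleC_right: "x * (z *\<^sub>C y) = z *\<^sub>C (x * y)"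

abbreviation clinear :: "('a::complex_vector \<Rightarrow> 'b::complex_vector) \<Rightarrow> bool" where
  "clinear \<equiv> Vector_Spaces.linear scaleC scaleC"

lemma vector_space_scaleC: "vector_space (scaleC :: complex \<Rightarrow> 'a::complex_vector \<Rightarrow> 'a)"
  by unfold_locales (simp_all add: scaleC_add_right scaleC_add_left scaleC_scaleC scaleC_one)

lemma clinearI:
  assumes "\<And>x y. f (x + y) = f x + f y" and "\<And>z x. f (z *\<^sub>C x) = z *\<^sub>C f x"
  shows "clinear f"
  using assms
  by (simp add: Vector_Spaces.linear_iff vector_space_scaleC)

text \<open>The direct sum of two Banach spaces is the product type. Its library norm is
  \<open>sqrt ((norm a)\<^sup>2 + (norm b)\<^sup>2)\<close>, which is equivalent to \<open>norm a + norm b\<close>.\<close>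

instantiation prod :: (complex_vector, complex_vector) complex_vector
begin

definition scaleC_prod :: "complex \<Rightarrow> 'a \<times> 'b \<Rightarrow> 'a \<times> 'b" where
  "scaleC_prod z p = (z *\<^sub>C fst p, z *\<^sub>C snd p)"

instance
  by standard
    (simp_all add: scaleC_prod_def scaleC_add_right scaleC_add_left scaleC_scaleC scaleC_one
      scaleC_of_real scaleR_prod_def)

end

instance prod :: (complex_normed_vector, complex_normed_vector) complex_normed_vector
proof
  fix z :: complex and p :: "'a \<times> 'b"
  have "norm (z *\<^sub>C p) = sqrt ((cmod z)\<^sup>2 * ((norm (fst p))\<^sup>2 + (norm (snd p))\<^sup>2))"
    by (simp add: norm_prod_def scaleC_prod_def norm_scaleC power_mult_distrib distrib_left)
  then show "norm (z *\<^sub>C p) = cmod z * norm p"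
    by (simp add: norm_prod_def real_sqrt_mult)
qed

instance prod :: (complex_banach, complex_banach) complex_banach ..

section \<open>Banach algebra structures on a given Banach space\<close>

text \<open>The product on \<open>A \<oplus> B\<close> depends on \<open>T\<close>, so it cannot be a type class operation
  on the product type. A multiplication \<open>m\<close> on a Banach space is therefore passed as an argument.
  It makes the space a Banach algebra if it is submultiplicative for some equivalent norm;
  completeness is inherited from the original norm.\<close>

definition equivalent_cnorm :: "('a::complex_normed_vector \<Rightarrow> real) \<Rightarrow> bool" where
  "equivalent_cnorm N \<longleftrightarrow>
     (\<forall>x. N x = 0 \<longleftrightarrow> x = 0) \<and>
     (\<forall>x y. N (x + y) \<le> N x + N y) \<and>
     (\<forall>z x. N (z *\<^sub>C x) = cmod z * N x) \<and>
     (\<exists>c>0. \<exists>C>0. \<forall>x. c * norm x \<le> N x \<and> N x \<le> C * norm x)"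

definition banach_algebra_mult :: "('a::complex_banach \<Rightarrow> 'a \<Rightarrow> 'a) \<Rightarrow> bool" where
  "banach_algebra_mult m \<longleftrightarrow>
     (\<forall>x. clinear (\<lambda>y. m x y)) \<and> (\<forall>y. clinear (\<lambda>x. m x y)) \<and>
     (\<forall>x y z. m (m x y) z = m x (m y z)) \<and>
     (\<exists>N. equivalent_cnorm N \<and> (\<forall>x y. N (m x y) \<le> N x * N y))"

lemma banach_algebra_mult_times:
  "banach_algebra_mult ((*) :: 'a::complex_banach_algebra \<Rightarrow> 'a \<Rightarrow> 'a)"
proof -
  have "equivalent_cnorm (norm :: 'a \<Rightarrow> real)"
    unfolding equivalent_cnorm_def
    by (auto simp: norm_scaleC norm_triangle_ineq intro!: exI[of _ 1])
  then show ?thesis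
    unfolding banach_algebra_mult_def
    by (auto intro!: clinearI exI[of _ norm]
        simp: distrib_left distrib_right mult_scaleC_left mult_scaleC_right mult.assoc
          norm_mult_ineq)
qed

definition algebra_hom ::
  "('a::complex_vector \<Rightarrow> 'a \<Rightarrow> 'a) \<Rightarrow> ('b::complex_vector \<Rightarrow> 'b \<Rightarrow> 'b) \<Rightarrow> ('a \<Rightarrow> 'b) \<Rightarrow> bool" where
  "algebra_hom m m' f \<longleftrightarrow> clinear f \<and> (\<forall>x y. f (m x y) = m' (f x) (f y))"

definition banach_algebra_isomorphic ::
  "('a::complex_banach \<Rightarrow> 'a \<Rightarrow> 'a) \<Rightarrow> ('b::complex_banach \<Rightarrow> 'b \<Rightarrow> 'b) \<Rightarrow> bool" where
  "banach_algebra_isomorphic m m' \<longleftrightarrow>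
     (\<exists>f. algebra_hom m m' f \<and> bij f \<and> continuous_on UNIV f \<and> continuous_on UNIV (inv f))"

section \<open>The two products on the direct sum\<close>

fun T_mult :: "('b::complex_banach_algebra \<Rightarrow> 'a::complex_banach_algebra)
    \<Rightarrow> 'a \<times> 'b \<Rightarrow> 'a \<times> 'b \<Rightarrow> 'a \<times> 'b" where
  "T_mult T (a1, b1) (a2, b2) = (a1 * a2 + T b1 * a2 + a1 * T b2, b1 * b2)"

fun alg_mult :: "'a::complex_banach_algebra \<times> 'b::complex_banach_algebra
    \<Rightarrow> 'a \<times> 'b \<Rightarrow> 'a \<times> 'b" where
  "alg_mult (a1, b1) (a2, b2) = (a1 * a2, b1 * b2)"

fun T_map :: "('b::complex_banach_algebra \<Rightarrow> 'a::complex_banach_algebra)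
    \<Rightarrow> 'a \<times> 'b \<Rightarrow> 'a \<times> 'b" where
  "T_map T (a, b) = (a + T b, b)"

end

theory Submission
  imports Defs
begin

text \<open>The map \<open>\<phi>(a, b) = (a + T b, b)\<close> is a shear with inverse \<open>(a, b) \<mapsto> (a - T b, b)\<close>, so it is a
  linear homeomorphism, and it carries the product \<open>\<bullet>\<^sub>T\<close> to the coordinatewise one. Associativity
  of \<open>\<bullet>\<^sub>T\<close> is therefore inherited from the coordinatewise product, and an equivalent submultiplicative
  norm for \<open>\<bullet>\<^sub>T\<close> is \<open>x \<mapsto> \<parallel>\<phi> x\<parallel>\<close>.\<close>

lemma clinear_iff:
  "clinear f \<longleftrightarrow> (\<forall>x y. f (x + y) = f x + f y) \<and> (\<forall>z x. f (z *\<^sub>C x) = z *\<^sub>C f x)"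
  by (simp add: Vector_Spaces.linear_iff vector_space_scaleC)

text \<open>Real scaling is complex scaling by a real number; this opens the library facts on
  real-linear maps to complex-linear ones.\<close>

lemma clinear_imp_linear:
  assumes "clinear f"
  shows "linear f"
  using assms by (intro linearI) (simp_all add: clinear_iff flip: scaleC_of_real)

lemma clinear_inv:
  assumes "clinear f" "bij f"
  shows "clinear (inv f)"
proof (rule clinearI)
  have f_inv: "f (inv f y) = y" for y
    using assms(2) by (simp add: bij_is_surj surj_f_inv_f)
  have inv_f: "inv f (f x) = x" for x
    using assms(2) by (simp add: bij_is_inj)
  show "inv f (x + y) = inv f x + inv f y" for x y
    using assms(1) by (metis clinear_iff f_inv inv_f)
  show "inv f (z *\<^sub>C x) = z *\<^sub>C inv f x" for z x
    using assms(1) by (metis clinear_iff f_inv inv_f)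
qed

text \<open>Continuity at 0 gives a ball of radius \<open>d\<close> on which
  \<open>norm (f x) < 1\<close>, and homogeneity spreads this bound to the whole space. Applied to a
  map and to its inverse, it turns a linear homeomorphism into a two-sided norm estimate.\<close>

lemma linear_continuous_norm_bound:
  fixes f :: "'a::real_normed_vector \<Rightarrow> 'b::real_normed_vector"
  assumes "linear f" "continuous_on UNIV f"
  obtains C where "C > 0" "\<And>x. norm (f x) \<le> C * norm x"
proof -
  have "isCont f 0"
    using assms(2) by (simp add: continuous_on_eq_continuous_at)
  then obtain d where d: "d > 0" "\<And>x. norm x < d \<Longrightarrow> norm (f x) < 1"
    unfolding continuous_at_eps_delta using linear_0[OF assms(1)]
    by (metis dist_0_norm dist_commute zero_less_one)
  have "norm (f x) \<le> (2 / d) * norm x" for x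
  proof (cases "x = 0")
    case True
    then show ?thesis by (simp add: linear_0[OF assms(1)])
  next
    case False
    \<comment> \<open>This factor rescales \<open>x\<close> to norm \<open>d / 2\<close>, strictly
      inside the ball.\<close>
    define r where "r = d / (2 * norm x)"
    have "r > 0" using False d(1) by (simp add: r_def)
    have "norm (r *\<^sub>R x) < d" using False d(1) by (simp add: r_def)
    then have "norm (f (r *\<^sub>R x)) < 1" by (rule d(2))
    then have "r * norm (f x) < 1"
      using \<open>r > 0\<close> by (simp add: linear_scale[OF assms(1)])
    then show ?thesis
      using False d(1) by (simp add: r_def field_simps)
  qed
  then show ?thesis using that[of "2 / d"] d(1) by simp
qed

text \<open>Boundedness of \<open>f\<close> yields the upper constant and boundedness of
  \<open>inv f\<close> the lower one; injectivity makes the pulled-back norm definite.\<close>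

lemma equivalent_cnorm_pullback:
  assumes N: "equivalent_cnorm N"
    and f: "clinear f" "bij f" "continuous_on UNIV f" "continuous_on UNIV (inv f)"
  shows "equivalent_cnorm (\<lambda>x. N (f x))"
proof -
  obtain C where C: "C > 0" "\<And>x. norm (f x) \<le> C * norm x"
    using linear_continuous_norm_bound[OF clinear_imp_linear[OF f(1)] f(3)] by blast
  obtain D where D: "D > 0" "\<And>y. norm (inv f y) \<le> D * norm y"
    using linear_continuous_norm_bound[OF clinear_imp_linear[OF clinear_inv[OF f(1,2)]] f(4)] by blast
  obtain c K where cK: "c > 0" "K > 0" "\<And>x. c * norm x \<le> N x" "\<And>x. N x \<le> K * norm x"
    using N unfolding equivalent_cnorm_def by blast
  have inv_f: "inv f (f x) = x" for x
    using f(2) by (simp add: bij_is_inj)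
  have lower: "c / D * norm x \<le> N (f x)" for x
  proof -
    have "norm x \<le> D * norm (f x)" using D(2)[of "f x"] by (simp add: inv_f)
    then have "c / D * norm x \<le> c / D * (D * norm (f x))"
      using cK(1) D(1) by (intro mult_left_mono) auto
    also have "\<dots> = c * norm (f x)" using D(1) by simp
    also have "\<dots> \<le> N (f x)" by (rule cK(3))
    finally show ?thesis .
  qed
  have upper: "N (f x) \<le> K * C * norm x" for x
    using order_trans[OF cK(4) mult_left_mono[OF C(2) less_imp_le[OF cK(2)]]]
    by (simp add: mult.assoc)
  have "\<exists>c>0. \<exists>C>0. \<forall>x. c * norm x \<le> N (f x) \<and> N (f x) \<le> C * norm x"
    using lower upper cK(1,2) C(1) D(1)
    by (intro exI[of _ "c / D"] exI[of _ "K * C"] conjI) auto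
  moreover have "f x = 0 \<longleftrightarrow> x = 0" for x
    using linear_0[OF clinear_imp_linear[OF f(1)]] inv_f by metis
  ultimately show ?thesis
    using N f(1) unfolding equivalent_cnorm_def clinear_iff by simp
qed

text \<open>Since \<open>f\<close> is injective, each law for \<open>m\<close> may be checked after
  applying \<open>f\<close>, where \<open>hom\<close> turns it into the same law for
  \<open>m'\<close>. The pulled-back norm is submultiplicative for the same reason.\<close>

lemma banach_algebra_mult_pullback:
  assumes m': "banach_algebra_mult m'"
    and f: "clinear f" "bij f" "continuous_on UNIV f" "continuous_on UNIV (inv f)"
    and hom: "\<And>x y. f (m x y) = m' (f x) (f y)"
  shows "banach_algebra_mult m"
proof -
  obtain N where N: "equivalent_cnorm N" "\<And>x y. N (m' x y) \<le> N x * N y"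
    using m' unfolding banach_algebra_mult_def by blast
  have lin: "f (x + y) = f x + f y" "f (z *\<^sub>C x) = z *\<^sub>C f x" for x y z
    using f(1) by (auto simp: clinear_iff)
  have m'_rules: "m' u (v + w) = m' u v + m' u w" "m' (u + v) w = m' u w + m' v w"
      "m' u (z *\<^sub>C v) = z *\<^sub>C m' u v" "m' (z *\<^sub>C u) v = z *\<^sub>C m' u v"
      "m' (m' u v) w = m' u (m' v w)" for u v w z
    using m' unfolding banach_algebra_mult_def clinear_iff by auto
  have inj: "x = y" if "f x = f y" for x y
    using f(2) that by (auto dest: bij_is_inj injD)
  have "equivalent_cnorm (\<lambda>x. N (f x))"
    by (rule equivalent_cnorm_pullback[OF N(1) f])
  moreover have "N (f (m x y)) \<le> N (f x) * N (f y)" for x y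
    by (simp add: hom N(2))
  ultimately show ?thesis
    unfolding banach_algebra_mult_def
    by (auto intro!: clinearI inj exI[of _ "\<lambda>x. N (f x)"] simp: hom lin m'_rules)
qed

lemma norm_Pair_times_le:
  fixes a c :: "'a::real_normed_algebra" and b d :: "'b::real_normed_algebra"
  shows "norm (a * c, b * d) \<le> norm (a, b) * norm (c, d)"
proof -
  have "(norm (a * c))\<^sup>2 + (norm (b * d))\<^sup>2 \<le> (norm a * norm c)\<^sup>2 + (norm b * norm d)\<^sup>2"
    by (intro add_mono power_mono norm_mult_ineq norm_ge_zero)
  \<comment> \<open>The right side exceeds the left by the mixed products of squares, which are
    nonnegative.\<close>
  also have "\<dots> \<le> ((norm a)\<^sup>2 + (norm b)\<^sup>2) * ((norm c)\<^sup>2 + (norm d)\<^sup>2)"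
    by (simp add: algebra_simps)
  finally show ?thesis
    by (simp add: norm_Pair flip: real_sqrt_mult)
qed

text \<open>The Euclidean product norm is itself submultiplicative here, so it serves as the
  required equivalent norm.\<close>

lemma banach_algebra_mult_alg_mult:
  "banach_algebra_mult (alg_mult :: 'a::complex_banach_algebra \<times> 'b::complex_banach_algebra \<Rightarrow> _)"
proof -
  have "equivalent_cnorm (norm :: 'a \<times> 'b \<Rightarrow> real)"
    unfolding equivalent_cnorm_def
    by (auto simp: norm_scaleC norm_triangle_ineq intro!: exI[of _ 1])
  then show ?thesis
    unfolding banach_algebra_mult_def
    by (auto intro!: clinearI exI[of _ norm]
        simp: scaleC_prod_def distrib_left distrib_right mult_scaleC_left mult_scaleC_right
          mult.assoc norm_Pair_times_le)
qed

text \<open>The form with projections exposes the map to the continuity rules, which the equation on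
  pairs does not.\<close>

lemma T_map_altdef: "T_map T = (\<lambda>x. (fst x + T (snd x), snd x))"
  by auto

lemma inv_T_map: "inv (T_map T) = (\<lambda>x. (fst x - T (snd x), snd x))"
  by (rule inv_equality) (auto simp: T_map_altdef)

lemma bij_T_map: "bij (T_map T)"
  by (rule o_bij[of "\<lambda>x. (fst x - T (snd x), snd x)"]) (auto simp: T_map_altdef)

lemma continuous_on_T_map:
  assumes "continuous_on UNIV T"
  shows "continuous_on UNIV (T_map T)" "continuous_on UNIV (inv (T_map T))"
  unfolding T_map_altdef[of T] inv_T_map[unfolded T_map_altdef]
  by (intro continuous_intros continuous_on_compose2[OF assms]; simp)+

lemma clinear_T_map:
  assumes "clinear T"
  shows "clinear (T_map T)"
  using assms unfolding T_map_altdef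
  by (intro clinearI) (auto simp: clinear_iff scaleC_prod_def scaleC_add_right)

text \<open>Expanding \<open>(a + T b) * (c + T d)\<close> gives the first component of the twisted
  product plus \<open>T b * T d\<close>, and multiplicativity of \<open>T\<close> makes this last
  term \<open>T (b * d)\<close>.\<close>

lemma T_map_T_mult:
  assumes "algebra_hom (*) (*) T"
  shows "T_map T (T_mult T x y) = alg_mult (T_map T x) (T_map T y)"
  using assms by (cases x; cases y) (simp add: algebra_hom_def algebra_simps)

theorem proposition3:
  fixes T :: "'b::complex_banach_algebra \<Rightarrow> 'a::complex_banach_algebra"
  assumes "algebra_hom (*) (*) T" and "continuous_on UNIV T"
  shows "continuous_on UNIV (T_map T) \<and> clinear (T_map T) \<and> bij (T_map T) \<and>
    (\<forall>a c b d. T_map T (T_mult T (a, b) (c, d)) = alg_mult (T_map T (a, b)) (T_map T (c, d))) \<and>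
    banach_algebra_mult (T_mult T) \<and>
    banach_algebra_mult (alg_mult :: 'a \<times> 'b \<Rightarrow> 'a \<times> 'b \<Rightarrow> 'a \<times> 'b) \<and>
    banach_algebra_isomorphic (T_mult T) (alg_mult :: 'a \<times> 'b \<Rightarrow> 'a \<times> 'b \<Rightarrow> 'a \<times> 'b)"
proof -
  have lin: "clinear (T_map T)"
    using assms(1) by (intro clinear_T_map) (simp add: algebra_hom_def)
  note hom = T_map_T_mult[OF assms(1)]
  note cont = continuous_on_T_map[OF assms(2)]
  have "banach_algebra_mult (T_mult T)"
    by (rule banach_algebra_mult_pullback[where f = "T_map T" and m' = alg_mult])
      (fact banach_algebra_mult_alg_mult lin bij_T_map cont hom)+
  moreover have "banach_algebra_isomorphic (T_mult T) (alg_mult :: 'a \<times> 'b \<Rightarrow> _)"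
    unfolding banach_algebra_isomorphic_def algebra_hom_def
    by (intro exI[of _ "T_map T"] conjI allI lin hom bij_T_map cont)
  ultimately show ?thesis
    using lin hom bij_T_map cont(1) banach_algebra_mult_alg_mult by blast
qed

end
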